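(* Let $P$ be a poset and $\prec$ an auxiliary relation on $P$. The following are equivalent: (1) $\prec$ satisfies the interpolation property: for all $x,z\in P$, if $x\prec z$ then there is $y\in P$ with $x\prec y\prec z$. (2) $(A^{\downarrow\prec})^{\downarrow\prec}=A^{\downarrow\prec}$ for every upper set $A$ of $P$. (3) The map $A\mapsto A^{\downarrow\prec}$ is a kernel operator on the lattice $(\mathcal{U}(P),\subseteq)$ of upper sets of $P$. (4) $(B^{\uparrow\prec})^{\uparrow\prec}=B^{\uparrow\prec}$ for every lower set $B$ of $P$. (5) The map $B\mapsto B^{\uparrow\prec}$ is a closure operator on the lattice $(\mathcal{L}(P),\subseteq)$ of lower sets of $P$.
   Context: For a poset $(P,\le)$ and $X\subseteq P$, $\mathord{\downarrow}X=\{x\mid \exists y\in X,\ x\le y\}$, $\mathord{\uparrow}X$ dually; lower/upper sets are those with $X=\mathord{\downarrow}X$ / $X=\mathord{\uparrow}X$; $\mathcal{U}(P)$ and $\mathcal{L}(P)$ are the sets of upper and lower sets. An auxiliary relation on $P$ is a binary relation $\prec$ such that: $x\prec y$ implies $x\le y$; $u\le x\prec y\le z$ implies $u\prec z$; if $P$ has a least element $\bot$ then $\bot\prec x$ for all $x$. Write $s_\prec(x)=\{y\mid y\prec x\}$. For $A\subseteq P$: $A^{\downarrow\prec}=\{x\in A\mid s_\prec(x)\cap A\neq\emptyset\}$ and $A^{\uparrow\prec}=\{x\in P\mid s_\prec(x)\subseteq\mathord{\downarrow}A\}$. A closure (kernel) operator on a poset $L$ is a monotone idempotent self-map $f$ with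 $x\le f(x)$ (resp. $f(x)\le x$) for all $x$. *)

theory Defs
  imports "HOL-Algebra.Order"
begin

section \<open>Lower and upper sets\<close>

definition down :: "('a, 'b) gorder_scheme \<Rightarrow> 'a set \<Rightarrow> 'a set"
  where "down P X = {x \<in> carrier P. \<exists>y\<in>X. x \<sqsubseteq>\<^bsub>P\<^esub> y}"

definition up :: "('a, 'b) gorder_scheme \<Rightarrow> 'a set \<Rightarrow> 'a set"
  where "up P X = {x \<in> carrier P. \<exists>y\<in>X. y \<sqsubseteq>\<^bsub>P\<^esub> x}"

definition lower_sets :: "('a, 'b) gorder_scheme \<Rightarrow> 'a set set"
  where "lower_sets P = {X. X \<subseteq> carrier P \<and> X = down P X}"

definition upper_sets :: "('a, 'b) gorder_scheme \<Rightarrow> 'a set set"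
  where "upper_sets P = {X. X \<subseteq> carrier P \<and> X = up P X}"

definition lower_set_lattice :: "('a, 'b) gorder_scheme \<Rightarrow> 'a set gorder"
  where "lower_set_lattice P = \<lparr>carrier = lower_sets P, eq = (=), le = (\<subseteq>)\<rparr>"

definition upper_set_lattice :: "('a, 'b) gorder_scheme \<Rightarrow> 'a set gorder"
  where "upper_set_lattice P = \<lparr>carrier = upper_sets P, eq = (=), le = (\<subseteq>)\<rparr>"

section \<open>Closure and kernel operators\<close>

definition closure_operator :: "('a, 'b) gorder_scheme \<Rightarrow> ('a \<Rightarrow> 'a) \<Rightarrow> bool"
  where "closure_operator L f \<longleftrightarrow>
    f \<in> carrier L \<rightarrow> carrier L \<and> isotone L L f \<and> idempotent L f \<and>
    (\<forall>x\<in>carrier L. x \<sqsubseteq>\<^bsub>L\<^esub> f x)"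

definition kernel_operator :: "('a, 'b) gorder_scheme \<Rightarrow> ('a \<Rightarrow> 'a) \<Rightarrow> bool"
  where "kernel_operator L f \<longleftrightarrow>
    f \<in> carrier L \<rightarrow> carrier L \<and> isotone L L f \<and> idempotent L f \<and>
    (\<forall>x\<in>carrier L. f x \<sqsubseteq>\<^bsub>L\<^esub> x)"

section \<open>Auxiliary relations\<close>

text \<open>A binary relation on \<open>P\<close> is given by a predicate on the ambient type of which only the
  values on \<open>carrier P\<close> matter: all notions below are relativised to the carrier.\<close>

locale auxiliary_relation = partial_order P for P (structure) +
  fixes prec :: "'a \<Rightarrow> 'a \<Rightarrow> bool"
  assumes prec_le: "\<lbrakk>x \<in> carrier P; y \<in> carrier P; prec x y\<rbrakk> \<Longrightarrow> x \<sqsubseteq> y"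
    and le_prec_le: "\<lbrakk>u \<in> carrier P; x \<in> carrier P; y \<in> carrier P; z \<in> carrier P;
      u \<sqsubseteq> x; prec x y; y \<sqsubseteq> z\<rbrakk> \<Longrightarrow> prec u z"
    and bottom_prec: "\<lbrakk>least P b (carrier P); x \<in> carrier P\<rbrakk> \<Longrightarrow> prec b x"

definition interpolation_property ::
    "('a, 'b) gorder_scheme \<Rightarrow> ('a \<Rightarrow> 'a \<Rightarrow> bool) \<Rightarrow> bool"
  where "interpolation_property P prec \<longleftrightarrow>
    (\<forall>x\<in>carrier P. \<forall>z\<in>carrier P. prec x z \<longrightarrow> (\<exists>y\<in>carrier P. prec x y \<and> prec y z))"

definition prec_below :: "('a, 'b) gorder_scheme \<Rightarrow> ('a \<Rightarrow> 'a \<Rightarrow> bool) \<Rightarrow> 'a \<Rightarrow> 'a set"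
  where "prec_below P prec x = {y \<in> carrier P. prec y x}"

text \<open>For \<open>A \<subseteq> carrier P\<close>, the next two sets are usually written \<open>A\<close> with superscript
  \<open>\<down>\<prec>\<close> and \<open>\<up>\<prec>\<close> respectively.\<close>

definition prec_down :: "('a, 'b) gorder_scheme \<Rightarrow> ('a \<Rightarrow> 'a \<Rightarrow> bool) \<Rightarrow> 'a set \<Rightarrow> 'a set"
  where "prec_down P prec A = {x \<in> A. prec_below P prec x \<inter> A \<noteq> {}}"

definition prec_up :: "('a, 'b) gorder_scheme \<Rightarrow> ('a \<Rightarrow> 'a \<Rightarrow> bool) \<Rightarrow> 'a set \<Rightarrow> 'a set"
  where "prec_up P prec A = {x \<in> carrier P. prec_below P prec x \<subseteq> down P A}"

end

theory Submission
  imports Defs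
begin

text \<open>For an upper set \<open>A\<close> and a lower set \<open>B\<close> the operators are always monotone, with
  \<open>A\<^sup>\<down>\<^sup>\<prec> \<subseteq> A\<close> and \<open>B \<subseteq> B\<^sup>\<up>\<^sup>\<prec>\<close>, so only idempotence is at stake, and interpolation gives it at once.
  Conversely, for \<open>x \<prec> z\<close> the principal upper set \<open>A = \<up>x\<close> has \<open>A\<^sup>\<down>\<^sup>\<prec> = {w. x \<prec> w}\<close>, and its
  complement \<open>B\<close> has \<open>B\<^sup>\<up>\<^sup>\<prec> = {w. \<not> x \<prec> w}\<close>; idempotence at either set, read at \<open>z\<close>,
  yields \<open>w\<close> with \<open>x \<prec> w \<prec> z\<close>.\<close>

text \<open>By reflexivity every subset of the carrier lies in its own \<open>down\<close>, so being
  a fixed point reduces to closure under smaller elements.\<close>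

lemma lower_sets_iff:
  assumes "partial_order P"
  shows "B \<in> lower_sets P \<longleftrightarrow>
    B \<subseteq> carrier P \<and> (\<forall>x\<in>carrier P. \<forall>y\<in>B. x \<sqsubseteq>\<^bsub>P\<^esub> y \<longrightarrow> x \<in> B)"
proof -
  interpret partial_order P by (rule assms)
  show ?thesis
    unfolding lower_sets_def down_def by (auto 0 3 intro: le_refl)
qed

lemma upper_sets_iff:
  assumes "partial_order P"
  shows "A \<in> upper_sets P \<longleftrightarrow>
    A \<subseteq> carrier P \<and> (\<forall>x\<in>carrier P. \<forall>y\<in>A. y \<sqsubseteq>\<^bsub>P\<^esub> x \<longrightarrow> x \<in> A)"
proof -
  interpret partial_order P by (rule assms)
  show ?thesis
    unfolding upper_sets_def up_def by (auto 0 3 intro: le_refl)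
qed

text \<open>Discharges the order conditions built into \<open>isotone\<close> for both set
  lattices.\<close>

lemma weak_partial_order_subset:
  "weak_partial_order \<lparr>carrier = C, eq = (=), le = (\<subseteq>)\<rparr>"
  by unfold_locales auto

context auxiliary_relation
begin

lemma le_prec_trans:
  "\<lbrakk>u \<in> carrier P; x \<in> carrier P; y \<in> carrier P; u \<sqsubseteq> x; prec x y\<rbrakk> \<Longrightarrow> prec u y"
  using le_prec_le le_refl by blast

lemma prec_le_trans:
  "\<lbrakk>x \<in> carrier P; y \<in> carrier P; z \<in> carrier P; prec x y; y \<sqsubseteq> z\<rbrakk> \<Longrightarrow> prec x z"
  using le_prec_le le_refl by blast

lemmas lower_sets_iff' = lower_sets_iff [OF partial_order_axioms]
lemmas upper_sets_iff' = upper_sets_iff [OF partial_order_axioms]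

lemma prec_down_subset: "prec_down P prec A \<subseteq> A"
  unfolding prec_down_def by blast

lemma prec_down_mono: "A \<subseteq> A' \<Longrightarrow> prec_down P prec A \<subseteq> prec_down P prec A'"
  unfolding prec_down_def by blast

lemma prec_down_upper:
  assumes "A \<in> upper_sets P"
  shows "prec_down P prec A \<in> upper_sets P"
  using assms prec_le_trans
  unfolding upper_sets_iff' prec_down_def prec_below_def by blast

text \<open>A lower set equals its own \<open>down\<close>, which therefore disappears from the
  definition of \<open>prec_up\<close>.\<close>

lemma prec_up_lower_set:
  assumes "B \<in> lower_sets P"
  shows "prec_up P prec B = {x \<in> carrier P. \<forall>y\<in>carrier P. prec y x \<longrightarrow> y \<in> B}"
proof -
  have "down P B = B"
    using assms unfolding lower_sets_def by simp
  then show ?thesis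
    unfolding prec_up_def prec_below_def by auto
qed

lemma subset_prec_up:
  assumes "B \<in> lower_sets P"
  shows "B \<subseteq> prec_up P prec B"
  using assms prec_le unfolding prec_up_lower_set [OF assms] lower_sets_iff' by blast

lemma prec_up_mono: "B \<subseteq> B' \<Longrightarrow> prec_up P prec B \<subseteq> prec_up P prec B'"
  unfolding prec_up_def down_def by blast

lemma prec_up_lower:
  assumes "B \<in> lower_sets P"
  shows "prec_up P prec B \<in> lower_sets P"
  using prec_le_trans unfolding prec_up_lower_set [OF assms] lower_sets_iff' by blast

lemma interpolation_iff_prec_down_idem:
  "interpolation_property P prec \<longleftrightarrow>
    (\<forall>A\<in>upper_sets P. prec_down P prec (prec_down P prec A) = prec_down P prec A)"
proof (intro iffI ballI)
  fix A
  assume interp: "interpolation_property P prec" and A: "A \<in> upper_sets P"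
  have "x \<in> prec_down P prec (prec_down P prec A)" if x: "x \<in> prec_down P prec A" for x
  proof -
    from x A obtain y where y: "y \<in> A" "y \<in> carrier P" "x \<in> carrier P" "prec y x"
      unfolding prec_down_def prec_below_def upper_sets_iff' by blast
    with interp obtain w where w: "w \<in> carrier P" "prec y w" "prec w x"
      unfolding interpolation_property_def by blast
    \<comment> \<open>\<open>prec\<close> refines the order, so \<open>w\<close> lies above
      \<open>y\<close> in the upper set \<open>A\<close>.\<close>
    with A y have "w \<in> A"
      unfolding upper_sets_iff' using prec_le by blast
    \<comment> \<open>\<open>y\<close> witnesses that \<open>w\<close> survives the first
      application, and \<open>w\<close> that \<open>x\<close> survives the second.\<close>
    with x y w show ?thesis
      unfolding prec_down_def prec_below_def by blast
  qed
  then show "prec_down P prec (prec_down P prec A) = prec_down P prec A"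
    using prec_down_subset by blast
next
  assume idem: "\<forall>A\<in>upper_sets P. prec_down P prec (prec_down P prec A) = prec_down P prec A"
  show "interpolation_property P prec"
    unfolding interpolation_property_def
  proof (intro ballI impI)
    fix x z
    assume x: "x \<in> carrier P" and z: "z \<in> carrier P" and xz: "prec x z"
    define A where "A = {y \<in> carrier P. x \<sqsubseteq> y}"
    have A: "A \<in> upper_sets P"
      unfolding upper_sets_iff' A_def using le_trans x by blast
    \<comment> \<open>Any witness \<open>y\<close> in \<open>A\<close> with \<open>prec y w\<close>
      satisfies \<open>x \<sqsubseteq> y\<close>, hence \<open>prec x w\<close>; conversely
      \<open>x\<close> itself is a witness.\<close>
    have down_A: "prec_down P prec A = {w \<in> carrier P. prec x w}"
      unfolding prec_down_def prec_below_def A_def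
      using x prec_le le_prec_trans le_refl by blast
    have "z \<in> prec_down P prec (prec_down P prec A)"
      using idem A z xz down_A by blast
    then show "\<exists>y\<in>carrier P. prec x y \<and> prec y z"
      unfolding down_A unfolding prec_down_def prec_below_def by blast
  qed
qed

lemma interpolation_iff_prec_up_idem:
  "interpolation_property P prec \<longleftrightarrow>
    (\<forall>B\<in>lower_sets P. prec_up P prec (prec_up P prec B) = prec_up P prec B)"
proof (intro iffI ballI)
  fix B
  assume interp: "interpolation_property P prec" and B: "B \<in> lower_sets P"
  \<comment> \<open>If \<open>prec y x\<close> with \<open>x\<close> in the left side, an
    interpolant between \<open>y\<close> and \<open>x\<close> lies in
    \<open>prec_up P prec B\<close>, which forces \<open>y\<close> into \<open>B\<close>.\<close>
  have "prec_up P prec (prec_up P prec B) \<subseteq> prec_up P prec B"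
    using interp
    unfolding prec_up_lower_set [OF prec_up_lower [OF B]] interpolation_property_def
    unfolding prec_up_lower_set [OF B] by blast
  then show "prec_up P prec (prec_up P prec B) = prec_up P prec B"
    using subset_prec_up [OF prec_up_lower [OF B]] by blast
next
  assume idem: "\<forall>B\<in>lower_sets P. prec_up P prec (prec_up P prec B) = prec_up P prec B"
  show "interpolation_property P prec"
    unfolding interpolation_property_def
  proof (intro ballI impI)
    fix x z
    assume x: "x \<in> carrier P" and z: "z \<in> carrier P" and xz: "prec x z"
    define B where "B = {y \<in> carrier P. \<not> x \<sqsubseteq> y}"
    have B: "B \<in> lower_sets P"
      unfolding lower_sets_iff' B_def using le_trans x by blast
    have up_B: "prec_up P prec B = {w \<in> carrier P. \<not> prec x w}"
      unfolding prec_up_lower_set [OF B] unfolding B_def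
      using x le_prec_trans le_refl by blast
    have "z \<notin> prec_up P prec (prec_up P prec B)"
      using idem B xz up_B by blast
    \<comment> \<open>Some \<open>y\<close> with \<open>prec y z\<close> lies outside
      \<open>prec_up P prec B\<close>, which by \<open>up_B\<close> means
      \<open>prec x y\<close>.\<close>
    then show "\<exists>y\<in>carrier P. prec x y \<and> prec y z"
      unfolding prec_up_lower_set [OF prec_up_lower [OF B]] using z up_B by blast
  qed
qed

text \<open>All the other conditions hold unconditionally, and \<open>eq\<close> of the lattice is
  equality, so \<open>idempotent\<close> is the right-hand side.\<close>

lemma kernel_operator_prec_down_iff:
  "kernel_operator (upper_set_lattice P) (prec_down P prec) \<longleftrightarrow>
    (\<forall>A\<in>upper_sets P. prec_down P prec (prec_down P prec A) = prec_down P prec A)"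
  unfolding kernel_operator_def isotone_def idempotent_def upper_set_lattice_def
  using prec_down_upper prec_down_mono prec_down_subset
  by (simp add: weak_partial_order_subset)

lemma closure_operator_prec_up_iff:
  "closure_operator (lower_set_lattice P) (prec_up P prec) \<longleftrightarrow>
    (\<forall>B\<in>lower_sets P. prec_up P prec (prec_up P prec B) = prec_up P prec B)"
  unfolding closure_operator_def isotone_def idempotent_def lower_set_lattice_def
  using prec_up_lower prec_up_mono subset_prec_up
  by (simp add: weak_partial_order_subset)

end

theorem theorem3p9:
  fixes P :: "('a, 'b) gorder_scheme" and prec :: "'a \<Rightarrow> 'a \<Rightarrow> bool"
  assumes "partial_order P" and "auxiliary_relation P prec"
  shows
    "(interpolation_property P prec \<longleftrightarrow>
        (\<forall>A\<in>upper_sets P. prec_down P prec (prec_down P prec A) = prec_down P prec A)) \<and>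
     (interpolation_property P prec \<longleftrightarrow>
        kernel_operator (upper_set_lattice P) (prec_down P prec)) \<and>
     (interpolation_property P prec \<longleftrightarrow>
        (\<forall>B\<in>lower_sets P. prec_up P prec (prec_up P prec B) = prec_up P prec B)) \<and>
     (interpolation_property P prec \<longleftrightarrow>
        closure_operator (lower_set_lattice P) (prec_up P prec))"
proof -
  interpret auxiliary_relation P prec by (rule assms)
  show ?thesis
    using interpolation_iff_prec_down_idem interpolation_iff_prec_up_idem
      kernel_operator_prec_down_iff closure_operator_prec_up_iff by blast
qed

end
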